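(* Let $p\in(0,1/2)$ be a fixed constant and let $\delta=\delta_n$ satisfy $\delta_n\to 0$ as $n\to\infty$. Then there exists an algorithm for the noisy $\mathsf{OR}$ problem on $n$ bits that, for every input $\mathbf{x}\in\{0,1\}^n$, outputs $\mathsf{OR}(\mathbf{x})$ with error probability at most $\delta$, and whose expected number of queries on every input is at most \[ (1+o(1))\frac{n\log\frac1\delta}{D_{\mathsf{KL}}(p\|1-p)}, \] where the $o(1)$ term tends to $0$ as $n\to\infty$ uniformly over inputs.
   Context: Noisy $\mathsf{OR}$ problem: an unknown $\mathbf{x}=(x_1,\dots,x_n)\in\{0,1\}^n$; $\mathsf{OR}(\mathbf{x})=1$ if some $x_i=1$ and $0$ otherwise. At each step the agent adaptively chooses an index $i\in[n]$ and observes $x_i\oplus Z$, where the noise bits $Z\sim\mathrm{Bern}(p)$ are i.i.d. across queries; the number of queries may be random and data-dependent. Logarithms are natural and $D_{\mathsf{KL}}(p\|1-p)=(1-2p)\log\frac{1-p}{p}$. *)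

theory Defs
  imports "HOL-Probability.Probability"
begin

definition OR :: "bool list \<Rightarrow> bool" where
  "OR x \<longleftrightarrow> (\<exists>i<length x. x ! i)"

text \<open>
  An algorithm is a map from the observations made so far (oldest first) to its next action:
  query an index or stop with an answer. The indices queried so far are
  determined by the observations, so they need not be recorded. Bit positions are numbered
  from \<open>0\<close>.
\<close>

datatype action = Query nat | Output bool

type_synonym algorithm = "bool list \<Rightarrow> action"

definition algorithm_on :: "nat \<Rightarrow> algorithm \<Rightarrow> bool" where
  "algorithm_on n A \<longleftrightarrow> (\<forall>h i. A h = Query i \<longrightarrow> i < n)"

text \<open>
  The observations after at most \<open>t\<close> queries on input \<open>x\<close>, when \<open>z s\<close> is the noise bit of the
  query number \<open>s\<close> (counted from \<open>0\<close>) and \<open>\<noteq>\<close> is exclusive or. The history is constant from the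
  moment the algorithm stops.
\<close>

primrec history :: "algorithm \<Rightarrow> bool list \<Rightarrow> (nat \<Rightarrow> bool) \<Rightarrow> nat \<Rightarrow> bool list" where
  "history A x z 0 = []"
| "history A x z (Suc t) =
    (case A (history A x z t) of
       Query i \<Rightarrow> history A x z t @ [x ! i \<noteq> z t]
     | Output b \<Rightarrow> history A x z t)"

definition outputs :: "algorithm \<Rightarrow> bool list \<Rightarrow> (nat \<Rightarrow> bool) \<Rightarrow> bool \<Rightarrow> bool" where
  "outputs A x z b \<longleftrightarrow> (\<exists>t. A (history A x z t) = Output b)"

text \<open>The infimum of the empty set is \<open>\<infinity>\<close>, the value for a run that never stops.\<close>

definition num_queries :: "algorithm \<Rightarrow> bool list \<Rightarrow> (nat \<Rightarrow> bool) \<Rightarrow> enat" where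
  "num_queries A x z = (INF t\<in>{t. \<exists>b. A (history A x z t) = Output b}. enat t)"

definition noise :: "real \<Rightarrow> (nat \<Rightarrow> bool) measure" where
  "noise p = (\<Pi>\<^sub>M t\<in>UNIV. measure_pmf (bernoulli_pmf p))"

text \<open>A run that never stops counts as an error.\<close>

definition error_prob :: "real \<Rightarrow> algorithm \<Rightarrow> bool list \<Rightarrow> real" where
  "error_prob p A x = measure (noise p) {z \<in> space (noise p). \<not> outputs A x z (OR x)}"

definition expected_queries :: "real \<Rightarrow> algorithm \<Rightarrow> bool list \<Rightarrow> ennreal" where
  "expected_queries p A x = (\<integral>\<^sup>+ z. ennreal_of_enat (num_queries A x z) \<partial>noise p)"

text \<open>
  The divergence of \<open>Bern(p)\<close> from \<open>Bern(q)\<close>, with natural logarithm. The library function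
  \<open>KL_divergence b M N\<close> has the reference measure \<open>M\<close> first.
\<close>

definition KL_bernoulli :: "real \<Rightarrow> real \<Rightarrow> real" where
  "KL_bernoulli p q =
     KL_divergence (exp 1) (measure_pmf (bernoulli_pmf q)) (measure_pmf (bernoulli_pmf p))"

lemma KL_bernoulli_compl:
  assumes "0 < p" "p < 1"
  shows "KL_bernoulli p (1 - p) = (1 - 2 * p) * ln ((1 - p) / p)"
proof -
  interpret sigma_finite_measure "count_space (UNIV :: bool set)"
    by (rule sigma_finite_measure_count_space)
  let ?f = "pmf (bernoulli_pmf (1 - p))" and ?g = "pmf (bernoulli_pmf p)"
  have "KL_bernoulli p (1 - p) =
      KL_divergence (exp 1) (density (count_space UNIV) ?f) (density (count_space UNIV) ?g)"
    by (simp add: KL_bernoulli_def measure_pmf_eq_density)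
  also have "\<dots> = (\<integral>b. ?g b * log (exp 1) (?g b / ?f b) \<partial>count_space UNIV)"
  proof (rule KL_density_density)
    have "?f b \<noteq> 0" for b
      using assms by (cases b) auto
    then show "AE b in count_space UNIV. ?f b = 0 \<longrightarrow> ?g b = 0"
      by simp
  qed auto
  also have "\<dots> = (\<Sum>b\<in>UNIV. ?g b * ln (?g b / ?f b))"
    by (simp add: lebesgue_integral_count_space_finite log_def)
  also have "\<dots> = p * ln (p / (1 - p)) + (1 - p) * ln ((1 - p) / p)"
    using assms by (simp add: UNIV_bool)
  also have "\<dots> = (1 - 2 * p) * ln ((1 - p) / p)"
    using assms by (simp add: ln_div algebra_simps)
  finally show ?thesis .
qed

lemma outputs_unique:
  assumes "outputs A x z b" "outputs A x z b'"
  shows "b = b'"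
proof -
  have stay: "A (history A x z (t + k)) = Output c \<and> history A x z (t + k) = history A x z t"
    if "A (history A x z t) = Output c" for t k c
    using that by (induction k) auto
  from assms obtain s t where "A (history A x z s) = Output b" "A (history A x z t) = Output b'"
    by (auto simp: outputs_def)
  with stay[of s b t] stay[of t b' s] show ?thesis
    by (simp add: add.commute)
qed

lemma measurable_history: "(\<lambda>z. history A x z t) \<in> noise p \<rightarrow>\<^sub>M count_space UNIV"
proof (induction t)
  case (Suc t)
  have z: "(\<lambda>z. z t) \<in> noise p \<rightarrow>\<^sub>M count_space UNIV"
    unfolding noise_def
    by (rule measurable_compose[OF measurable_component_singleton]) auto
  have "(\<lambda>z. (\<lambda>h b. case A h of Query i \<Rightarrow> h @ [x ! i \<noteq> b] | Output c \<Rightarrow> h)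
          (history A x z t) (z t)) \<in> noise p \<rightarrow>\<^sub>M count_space UNIV"
    by (rule measurable_compose_countable[OF _ Suc.IH])
       (rule measurable_compose[OF z], simp)
  then show ?case
    by simp
qed simp

lemma measurable_outputs: "{z \<in> space (noise p). outputs A x z b} \<in> sets (noise p)"
proof -
  have "{z \<in> space (noise p). A (history A x z t) = Output b} \<in> sets (noise p)" for t
    using measurable_sets[OF measurable_history[of A x t p], of "{h. A h = Output b}"]
    by (simp add: vimage_def Int_def conj_commute)
  then have "(\<Union>t. {z \<in> space (noise p). A (history A x z t) = Output b}) \<in> sets (noise p)"
    by blast
  also have "(\<Union>t. {z \<in> space (noise p). A (history A x z t) = Output b})
      = {z \<in> space (noise p). outputs A x z b}"
    by (auto simp: outputs_def)
  finally show ?thesis .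
qed

lemma measurable_num_queries:
  "(\<lambda>z. ennreal_of_enat (num_queries A x z)) \<in> borel_measurable (noise p)"
proof -
  define g where "g t h = (if \<exists>b. A h = Output b then enat t else \<infinity>)" for t h
  have nq: "num_queries A x = (\<lambda>z. INF t. g t (history A x z t))"
  proof
    fix z
    show "num_queries A x z = (INF t. g t (history A x z t))"
      unfolding num_queries_def
    proof (rule antisym; rule INF_greatest)
      fix t
      show "(INF t\<in>{t. \<exists>b. A (history A x z t) = Output b}. enat t) \<le> g t (history A x z t)"
        by (auto simp: g_def intro: INF_lower)
    next
      fix t
      assume "t \<in> {t. \<exists>b. A (history A x z t) = Output b}"
      then show "(INF t. g t (history A x z t)) \<le> enat t"
        by (intro INF_lower2[of t]) (auto simp: g_def)
    qed
  qed
  have "(\<lambda>z. g t (history A x z t)) \<in> noise p \<rightarrow>\<^sub>M count_space UNIV" for t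
    by (rule measurable_compose[OF measurable_history]) simp
  then have "num_queries A x \<in> noise p \<rightarrow>\<^sub>M count_space UNIV"
    unfolding nq by measurable
  then show ?thesis
    by (rule measurable_compose) simp
qed

end

theory Submission
  imports Defs "HOL-Real_Asymp.Real_Asymp"
begin

text \<open>
  The bits are tested one after the other. For each bit the difference between the numbers of
  observed ones and zeros is a random walk, run until it falls by \<open>a\<close> (the bit is believed
  to be \<open>0\<close>, and the next one is tested) or rises by \<open>b\<close> (answer \<open>1\<close>). With \<open>r = p / (1 - p)\<close>, a
  zero bit is mistaken for a one with probability at most \<open>r ^ b\<close> and a one bit for a zero
  with probability at most \<open>r ^ a\<close>. Only the first kind of error needs a union bound over the \<open>n\<close>
  bits, so \<open>r ^ b \<le> \<delta> / n\<close> and \<open>r ^ a \<le> \<delta>\<close> suffice. A zero bit costs at most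
  \<open>a / (1 - 2 p)\<close> queries on average, and the tests of one bits, which cost \<open>b / (1 - 2 p)\<close>, are
  only \<open>O(1)\<close> many on average because each of them is likely to be the last; as
  \<open>b = O(ln (n / \<delta>)) = o(n ln (1 / \<delta>))\<close>, they are negligible.
\<close>

section \<open>Supermartingales along a run\<close>

lemma prob_space_noise: "prob_space (noise p)"
  unfolding noise_def by (intro prob_space_PiM measure_pmf.prob_space_axioms)

text \<open>An i.i.d. sequence is its first bit followed by an independent copy of itself
  (\<open>PiM_iter\<close>); conditioning on that bit gives the two terms.\<close>

lemma noise_unfold:
  assumes "0 \<le> p" "p \<le> 1" "G \<in> borel_measurable (noise p)"
  shows "(\<integral>\<^sup>+z. G z \<partial>noise p) =
    (\<integral>\<^sup>+z. G (case_nat True z) \<partial>noise p) * ennreal p +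
    (\<integral>\<^sup>+z. G (case_nat False z) \<partial>noise p) * ennreal (1 - p)"
proof -
  let ?M = "measure_pmf (bernoulli_pmf p)"
  interpret sequence_space ?M
    by unfold_locales
  have S: "noise p = S"
    by (simp add: noise_def)
  have [measurable]: "G \<in> borel_measurable S"
    using assms(3) by (simp add: S)
  have "(\<integral>\<^sup>+z. G z \<partial>S) = (\<integral>\<^sup>+z. G z \<partial>distr (?M \<Otimes>\<^sub>M S) S (\<lambda>(s, \<omega>). case_nat s \<omega>))"
    by (simp only: PiM_iter)
  also have "\<dots> = (\<integral>\<^sup>+y. G (case_nat (fst y) (snd y)) \<partial>(?M \<Otimes>\<^sub>M S))"
    by (subst nn_integral_distr) (simp_all add: split_beta)
  also have "\<dots> = (\<integral>\<^sup>+s. (\<integral>\<^sup>+\<omega>. G (case_nat s \<omega>) \<partial>S) \<partial>?M)"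
    by (subst P.nn_integral_fst[symmetric]) simp_all
  also have "\<dots> = (\<integral>\<^sup>+\<omega>. G (case_nat True \<omega>) \<partial>S) * ennreal p +
      (\<integral>\<^sup>+\<omega>. G (case_nat False \<omega>) \<partial>S) * ennreal (1 - p)"
    using assms(1,2) by (subst nn_integral_bernoulli_pmf) simp_all
  finally show ?thesis
    by (simp add: S)
qed

text \<open>Since an algorithm is a function of the observations alone, what remains after a first
  observation \<open>y\<close> is again an algorithm, \<open>\<lambda>h. A (y # h)\<close>, run on
  the shifted noise.\<close>

lemma history_case_nat:
  "history A x (case_nat b z) (Suc t) =
    (case A [] of
       Query i \<Rightarrow> (x ! i \<noteq> b) # history (\<lambda>h. A ((x ! i \<noteq> b) # h)) x z t
     | Output c \<Rightarrow> [])"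
proof (induction t)
  case (Suc t)
  show ?case
    by (subst history.simps(2), unfold Suc.IH nat.case) (auto split: action.split)
qed (auto split: action.split)

lemma measurable_history_fun [measurable]:
  "(\<lambda>z. f (history A x z t)) \<in> borel_measurable (noise p)"
  by (rule measurable_compose[OF measurable_history]) simp

text \<open>\<open>W\<close> is a supermartingale along the run. Conditioning on the first noise bit
  leaves the residual algorithm with the correspondingly shifted \<open>W\<close>, so the induction
  must generalize over both.\<close>

lemma nn_integral_history_le:
  fixes W :: "bool list \<Rightarrow> real"
  assumes "0 \<le> p" "p \<le> 1" "\<And>h. 0 \<le> W h"
    and "\<And>h i. A h = Query i \<Longrightarrow> p * W (h @ [\<not> x ! i]) + (1 - p) * W (h @ [x ! i]) \<le> W h"
  shows "(\<integral>\<^sup>+z. ennreal (W (history A x z t)) \<partial>noise p) \<le> ennreal (W [])"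
  using assms(3,4)
proof (induction t arbitrary: A W)
  case 0
  interpret prob_space "noise p"
    by (rule prob_space_noise)
  show ?case
    by (simp add: emeasure_space_1)
next
  case (Suc t)
  interpret prob_space "noise p"
    by (rule prob_space_noise)
  let ?I = "\<lambda>b. \<integral>\<^sup>+z. ennreal (W (history A x (case_nat b z) (Suc t))) \<partial>noise p"
  have split: "(\<integral>\<^sup>+z. ennreal (W (history A x z (Suc t))) \<partial>noise p) =
      ?I True * ennreal p + ?I False * ennreal (1 - p)"
    using assms(1,2) by (rule noise_unfold) (rule measurable_history_fun)
  show ?case
  proof (cases "A []")
    case (Query i)
    have I: "?I b \<le> ennreal (W [x ! i \<noteq> b])" for b
      unfolding history_case_nat Query action.case
      using Suc.prems(2)[of "(x ! i \<noteq> b) # _"]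
      by (intro Suc.IH[of "\<lambda>h. W ((x ! i \<noteq> b) # h)"]) (auto simp: Suc.prems(1))
    have "?I True * ennreal p + ?I False * ennreal (1 - p) \<le>
        ennreal (W [\<not> x ! i]) * ennreal p + ennreal (W [x ! i]) * ennreal (1 - p)"
      using I[of True] I[of False] by (intro add_mono mult_right_mono) simp_all
    also have "\<dots> = ennreal (p * W [\<not> x ! i] + (1 - p) * W [x ! i])"
      using assms(1,2) Suc.prems(1)
      by (simp add: ennreal_mult[symmetric] ennreal_plus[symmetric] mult.commute
          del: ennreal_plus)
    also have "\<dots> \<le> ennreal (W [])"
      using Suc.prems(2)[OF Query] by (simp add: ennreal_leI)
    finally show ?thesis
      unfolding split .
  next
    case (Output c)
    have "?I b = ennreal (W [])" for b
      unfolding history_case_nat Output action.case by (simp add: emeasure_space_1)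
    moreover have "ennreal p + ennreal (1 - p) = 1"
      using assms(1,2) by (simp add: ennreal_plus[symmetric] del: ennreal_plus)
    ultimately show ?thesis
      unfolding split by (metis distrib_left mult.right_neutral order_refl)
  qed
qed

text \<open>The history gains one entry per query and freezes at the stop. This form of the stopping
  time is an increasing limit, ready for monotone convergence.\<close>

lemma num_queries_eq_SUP_length:
  "num_queries A x z = (SUP t. enat (length (history A x z t)))"
proof (rule antisym)
  show "(SUP t. enat (length (history A x z t))) \<le> num_queries A x z"
    unfolding num_queries_def
  proof (intro SUP_least INF_greatest)
    fix s t
    assume "t \<in> {t. \<exists>b. A (history A x z t) = Output b}"
    then obtain b where b: "A (history A x z t) = Output b"
      by blast
    have le: "length (history A x z s) \<le> s" for s
      by (induction s) (auto split: action.split)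
    have stay: "history A x z (t + k) = history A x z t" for k
      using b by (induction k) auto
    have "length (history A x z s) \<le> t"
      using le[of s] le[of t] stay[of "s - t"] by (cases "s \<le> t") auto
    then show "enat (length (history A x z s)) \<le> enat t"
      by simp
  qed
next
  show "num_queries A x z \<le> (SUP t. enat (length (history A x z t)))"
  proof (cases "\<exists>t b. A (history A x z t) = Output b")
    case True
    define T where "T = (LEAST t. \<exists>b. A (history A x z t) = Output b)"
    have T: "\<exists>b. A (history A x z T) = Output b"
      unfolding T_def by (rule LeastI_ex) (rule True)
    have run: "\<exists>i. A (history A x z t) = Query i" if "t < T" for t
      using not_less_Least[of t "\<lambda>t. \<exists>b. A (history A x z t) = Output b"] that
      unfolding T_def[symmetric] by (cases "A (history A x z t)") auto
    have "length (history A x z t) = t" if "t \<le> T" for t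
      using that
    proof (induction t)
      case (Suc t)
      with run[of t] show ?case
        by auto
    qed simp
    then have "enat T = enat (length (history A x z T))"
      by simp
    also have "\<dots> \<le> (SUP t. enat (length (history A x z t)))"
      by (rule SUP_upper) simp
    finally show ?thesis
      unfolding num_queries_def using T by (intro INF_lower2[of T]) auto
  next
    case False
    have len: "length (history A x z t) = t" for t
      using False by (induction t) (auto split: action.split)
    have "(SUP t. enat t) = \<infinity>"
      unfolding SUP_eq_top_iff[where 'a = enat, unfolded top_enat_def]
      by (metis UNIV_I enat_ord_simps(4) lessI enat_ord_simps(2) enat.exhaust)
    then show ?thesis
      by (simp add: len)
  qed
qed

text \<open>Each query lowers \<open>V\<close> by at least 1 on average, so
  \<open>length h + V h\<close> is a supermartingale; as \<open>V\<close> is nonnegative, it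
  dominates the number of queries made so far.\<close>

lemma expected_queries_le:
  fixes V :: "bool list \<Rightarrow> real"
  assumes "0 \<le> p" "p \<le> 1" "\<And>h. 0 \<le> V h"
    and "\<And>h i. A h = Query i \<Longrightarrow>
      1 + p * V (h @ [\<not> x ! i]) + (1 - p) * V (h @ [x ! i]) \<le> V h"
  shows "expected_queries p A x \<le> ennreal (V [])"
proof -
  have "expected_queries p A x =
      (\<integral>\<^sup>+z. (SUP t. ennreal (real (length (history A x z t)))) \<partial>noise p)"
    unfolding expected_queries_def num_queries_eq_SUP_length
    by (simp add: ennreal_of_enat_Sup image_image ennreal_of_nat_eq_real_of_nat)
  also have "\<dots> = (SUP t. \<integral>\<^sup>+z. ennreal (real (length (history A x z t))) \<partial>noise p)"
    by (intro nn_integral_monotone_convergence_SUP)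
       (auto simp: incseq_Suc_iff le_fun_def split: action.split)
  also have "\<dots> \<le> ennreal (V [])"
  proof (rule SUP_least)
    fix t
    have "(\<integral>\<^sup>+z. ennreal (real (length (history A x z t))) \<partial>noise p) \<le>
        (\<integral>\<^sup>+z. ennreal (real (length (history A x z t)) + V (history A x z t)) \<partial>noise p)"
      by (intro nn_integral_mono ennreal_leI) (simp add: assms(3))
    also have "\<dots> \<le> ennreal (real (length ([] :: bool list)) + V [])"
      using assms(3,4)
      by (intro nn_integral_history_le[OF assms(1,2), where W = "\<lambda>h. real (length h) + V h"])
         (auto simp: algebra_simps)
    finally show "(\<integral>\<^sup>+z. ennreal (real (length (history A x z t))) \<partial>noise p) \<le> ennreal (V [])"
      by simp
  qed
  finally show ?thesis .
qed

text \<open>\<open>W\<close> dominates the indicator of having answered \<open>c\<close>. These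
  events increase with \<open>t\<close>, because an answer is final, so the bound passes to their
  union.\<close>

lemma prob_outputs_le:
  fixes W :: "bool list \<Rightarrow> real"
  assumes "0 \<le> p" "p \<le> 1" "\<And>h. 0 \<le> W h"
    and "\<And>h i. A h = Query i \<Longrightarrow> p * W (h @ [\<not> x ! i]) + (1 - p) * W (h @ [x ! i]) \<le> W h"
    and "\<And>h. A h = Output c \<Longrightarrow> 1 \<le> W h"
  shows "measure (noise p) {z \<in> space (noise p). outputs A x z c} \<le> W []"
proof -
  interpret prob_space "noise p"
    by (rule prob_space_noise)
  let ?E = "\<lambda>t. {z \<in> space (noise p). A (history A x z t) = Output c}"
  have sets: "?E t \<in> sets (noise p)" for t
    using measurable_sets[OF measurable_history[of A x t p], of "{h. A h = Output c}"]
    by (simp add: vimage_def Int_def conj_commute)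
  have "emeasure (noise p) {z \<in> space (noise p). outputs A x z c} =
      emeasure (noise p) (\<Union>t. ?E t)"
    by (rule arg_cong[where f = "emeasure (noise p)"]) (auto simp: outputs_def)
  also have "\<dots> = (SUP t. emeasure (noise p) (?E t))"
    using sets by (intro SUP_emeasure_incseq[symmetric]) (auto simp: incseq_Suc_iff)
  also have "\<dots> \<le> ennreal (W [])"
  proof (rule SUP_least)
    fix t
    have "emeasure (noise p) (?E t) = (\<integral>\<^sup>+z. indicator (?E t) z \<partial>noise p)"
      using sets by simp
    also have "\<dots> \<le> (\<integral>\<^sup>+z. ennreal (W (history A x z t)) \<partial>noise p)"
      using assms(5) by (intro nn_integral_mono) (auto split: split_indicator)
    also have "\<dots> \<le> ennreal (W [])"
      by (rule nn_integral_history_le[OF assms(1-4)])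
    finally show "emeasure (noise p) (?E t) \<le> ennreal (W [])" .
  qed
  finally show ?thesis
    using assms(3) by (simp add: emeasure_eq_measure)
qed

text \<open>A finite expectation makes runs that never stop a null event, and answers are
  unique.\<close>

lemma error_prob_eq_prob_wrong_output:
  assumes "expected_queries p A x < \<infinity>"
  shows "error_prob p A x =
    measure (noise p) {z \<in> space (noise p). outputs A x z (\<not> OR x)}"
  unfolding error_prob_def
proof (rule measure_eq_AE)
  have "AE z in noise p. ennreal_of_enat (num_queries A x z) \<noteq> \<infinity>"
    using assms unfolding expected_queries_def
    by (intro nn_integral_noteq_infinite measurable_num_queries) simp
  then show "AE z in noise p. (z \<in> {z \<in> space (noise p). \<not> outputs A x z (OR x)}) =
      (z \<in> {z \<in> space (noise p). outputs A x z (\<not> OR x)})"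
  proof eventually_elim
    case (elim z)
    have "\<exists>c. outputs A x z c"
    proof (rule ccontr)
      assume "\<nexists>c. outputs A x z c"
      then have "num_queries A x z = \<infinity>"
        by (simp add: num_queries_def outputs_def top_enat_def)
      with elim show False
        by simp
    qed
    then obtain c where "outputs A x z c"
      by blast
    then show ?case
      using outputs_unique[of A x z] by (cases "c = OR x") auto
  qed
  show "{z \<in> space (noise p). \<not> outputs A x z (OR x)} \<in> sets (noise p)"
    using sets.compl_sets[OF measurable_outputs[of p A x "OR x"]]
    by (simp add: set_diff_eq conj_commute cong: conj_cong)
qed (rule measurable_outputs)

section \<open>The sequential test\<close>

text \<open>
  The state \<open>(i, u)\<close> means that bit \<open>i\<close> is being tested and its walk, started at \<open>a\<close>, is at
  \<open>u\<close>; the walk is absorbed at \<open>0\<close> and at \<open>a + b\<close>.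
\<close>

fun test_step :: "nat \<Rightarrow> nat \<times> nat \<Rightarrow> bool \<Rightarrow> nat \<times> nat" where
  "test_step a (i, u) y = (if y then (i, Suc u) else if u = 1 then (Suc i, a) else (i, u - 1))"

text \<open>An algorithm sees only the observations, so the state is recomputed from them, oldest
  first.\<close>

definition test_state :: "nat \<Rightarrow> bool list \<Rightarrow> nat \<times> nat" where
  "test_state a = foldl (test_step a) (0, a)"

definition or_test :: "nat \<Rightarrow> nat \<Rightarrow> nat \<Rightarrow> algorithm" where
  "or_test n a b h =
    (case test_state a h of (i, u) \<Rightarrow>
       if n \<le> i then Output False else if a + b \<le> u then Output True else Query i)"

lemma test_state_simps [simp]:
  "test_state a [] = (0, a)"
  "test_state a (h @ [y]) = test_step a (test_state a h) y"
  by (simp_all add: test_state_def)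

lemma algorithm_on_or_test: "algorithm_on n (or_test n a b)"
  by (auto simp: algorithm_on_def or_test_def split: prod.splits if_splits)

lemma test_state_pos:
  assumes "0 < a"
  shows "0 < snd (test_state a h)"
proof (induction h rule: rev_induct)
  case (snoc y h)
  with assms show ?case
    by (cases "test_state a h") auto
qed (use assms in simp)

text \<open>Reduces the supermartingale condition on histories to an inequality on states. The walk
  rises with probability \<open>1 - p\<close> on a one bit and \<open>p\<close> on a zero bit;
  \<open>c\<close> is the charge per query, 0 for error bounds and 1 for the cost.\<close>

lemma or_test_potential_step:
  fixes U :: "nat \<Rightarrow> nat \<Rightarrow> real"
  assumes "0 < a" "or_test n a b h = Query j"
    and "\<And>i u. i < n \<Longrightarrow> 0 < u \<Longrightarrow> u < a + b \<Longrightarrow>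
      c + (if x ! i then 1 - p else p) * U i (Suc u) +
        (if x ! i then p else 1 - p) * (if u = 1 then U (Suc i) a else U i (u - 1)) \<le> U i u"
  shows "c + p * case_prod U (test_state a (h @ [\<not> x ! j])) +
    (1 - p) * case_prod U (test_state a (h @ [x ! j])) \<le> case_prod U (test_state a h)"
proof -
  obtain i u where s: "test_state a h = (i, u)"
    by fastforce
  then have "i < n" "0 < u" "u < a + b" "i = j"
    using assms(2) test_state_pos[OF assms(1), of h]
    by (auto simp: or_test_def split: if_splits)
  with assms(3)[of i u] s show ?thesis
    by (auto split: if_splits)
qed

section \<open>Error probabilities and expected cost of the sequential test\<close>

context
  fixes p r :: real and n a b :: nat
  assumes p: "0 < p" "p < 1 / 2" and r_def: "r = p / (1 - p)" and a: "0 < a"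
begin

lemma ratio_bounds: "0 < r" "r < 1"
  using p by (auto simp: r_def field_simps)

text \<open>\<open>r\<close> is a root of \<open>p + (1 - p) * r^2 = r\<close>. Hence
  \<open>r\<close> to the height is a martingale while a one bit is tested, and \<open>r\<close> to
  the distance from the top while a zero bit is tested.\<close>

lemma ratio_harmonic: "p * r ^ k + (1 - p) * r ^ Suc (Suc k) = r ^ Suc k"
proof -
  have "p = (1 - p) * r"
    using p by (simp add: r_def)
  then have "p + (1 - p) * (r * r) = r"
    by algebra
  then have "(p + (1 - p) * (r * r)) * r ^ k = r * r ^ k"
    by simp
  then show ?thesis
    by (simp add: algebra_simps)
qed

lemma ratio_harmonic': "(1 - p) * r ^ Suc (Suc k) + p * r ^ k = r ^ Suc k"
  using ratio_harmonic[of k] by simp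

lemma prob_false_positive_le:
  assumes n: "0 < n" and x: "\<And>i. i < n \<Longrightarrow> \<not> x ! i"
  shows "measure (noise p) {z \<in> space (noise p). outputs (or_test n a b) x z True} \<le> real n * r ^ b"
proof -
  \<comment> \<open>The first summand bounds the chance that the current walk reaches the top; each
    later bit, started at distance \<open>b\<close> from the top, adds \<open>r ^ b\<close>.\<close>
  define U where
    "U i u = (if i < n then r ^ (a + b - u) + real (n - Suc i) * r ^ b else 0)" for i u
  have U_nonneg: "0 \<le> case_prod U s" for s
    using ratio_bounds by (auto simp: U_def split: prod.split)
  have step: "0 + (if x ! i then 1 - p else p) * U i (Suc u) +
      (if x ! i then p else 1 - p) * (if u = 1 then U (Suc i) a else U i (u - 1)) \<le> U i u"
    if *: "i < n" "0 < u" "u < a + b" for i u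
  proof -
    define K where "K = real (n - Suc i) * r ^ b"
    obtain d where d: "a + b - u = Suc d"
      using * by (metis Suc_diff_Suc)
    have "U (Suc i) a = K"
    proof (cases "Suc i < n")
      case True
      then have "real (n - Suc i) = 1 + real (n - Suc (Suc i))"
        by linarith
      with True show ?thesis
        by (simp add: U_def K_def algebra_simps)
    qed (use * in \<open>simp add: U_def K_def\<close>)
    moreover have "0 \<le> r ^ Suc (Suc d)"
      using ratio_bounds by simp
    moreover have "U i (u - 1) = r ^ Suc (Suc d) + K" if "u \<noteq> 1"
    proof -
      have "a + b - (u - 1) = Suc (Suc d)"
        using that d * by linarith
      with * show ?thesis
        by (simp add: U_def K_def)
    qed
    \<comment> \<open>When the bit is given up at \<open>u = 1\<close>, the value is just
      \<open>K\<close>, and the nonnegative power is slack.\<close>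
    ultimately have D: "(if u = 1 then U (Suc i) a else U i (u - 1)) \<le> r ^ Suc (Suc d) + K"
      by simp
    have "U i (Suc u) = r ^ d + K" "U i u = r ^ Suc d + K"
      using * d by (auto simp: U_def K_def diff_Suc)
    with mult_left_mono[OF D, of "1 - p"] ratio_harmonic[of d] x[OF *(1)] p
    show ?thesis
      by (simp add: algebra_simps)
  qed
  have "measure (noise p) {z \<in> space (noise p). outputs (or_test n a b) x z True} \<le>
      case_prod U (test_state a [])"
  proof (rule prob_outputs_le)
    \<comment> \<open>At the top the truncated exponent \<open>a + b - u\<close> is 0, so the first
      summand is 1.\<close>
    show "1 \<le> case_prod U (test_state a h)" if "or_test n a b h = Output True" for h
      using that ratio_bounds by (auto simp: or_test_def U_def split: prod.splits if_splits)
    show "p * case_prod U (test_state a (h @ [\<not> x ! i])) +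
        (1 - p) * case_prod U (test_state a (h @ [x ! i])) \<le> case_prod U (test_state a h)"
      if "or_test n a b h = Query i" for h i
      using or_test_potential_step[OF a that step] by simp
  qed (use p U_nonneg in auto)
  also have "\<dots> = real n * r ^ b"
  proof -
    obtain m where "n = Suc m"
      using n gr0_conv_Suc by blast
    then show ?thesis
      by (simp add: U_def algebra_simps)
  qed
  finally show ?thesis .
qed

lemma prob_false_negative_le:
  assumes k: "k < n" "x ! k"
  shows "measure (noise p) {z \<in> space (noise p). outputs (or_test n a b) x z False} \<le> r ^ a"
proof -
  \<comment> \<open>Answering \<open>False\<close> requires the walk of bit \<open>k\<close> to fall
    from \<open>a\<close> to 0. The pieces fit at both handovers: bit \<open>k\<close> is entered
    with \<open>r ^ a\<close> and left downwards with \<open>r ^ 0 = 1\<close>.\<close>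
  define U where "U i u = (if i < k then r ^ a else if i = k then r ^ u else 1)" for i u :: nat
  have step: "0 + (if x ! i then 1 - p else p) * U i (Suc u) +
      (if x ! i then p else 1 - p) * (if u = 1 then U (Suc i) a else U i (u - 1)) \<le> U i u"
    if *: "0 < u" for i u
  proof -
    consider "i < k" | "i = k" | "k < i"
      by linarith
    then show ?thesis
    proof cases
      case 1
      then have "Suc i < k \<or> Suc i = k"
        by linarith
      with 1 show ?thesis
        by (auto simp: U_def algebra_simps)
    next
      case 2
      from * obtain v where "u = Suc v"
        using gr0_conv_Suc by blast
      with 2 k ratio_harmonic[of v] show ?thesis
        by (auto simp: U_def)
    qed (simp add: U_def)
  qed
  have "measure (noise p) {z \<in> space (noise p). outputs (or_test n a b) x z False} \<le>
      case_prod U (test_state a [])"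
  proof (rule prob_outputs_le)
    show "1 \<le> case_prod U (test_state a h)" if "or_test n a b h = Output False" for h
      using that k by (auto simp: or_test_def U_def split: prod.splits if_splits)
    show "p * case_prod U (test_state a (h @ [\<not> x ! i])) +
        (1 - p) * case_prod U (test_state a (h @ [x ! i])) \<le> case_prod U (test_state a h)"
      if "or_test n a b h = Query i" for h i
      using or_test_potential_step[OF a that step] by simp
    show "0 \<le> case_prod U (test_state a h)" for h
      using ratio_bounds by (auto simp: U_def split: prod.split)
  qed (use p in auto)
  also have "\<dots> = r ^ a"
    by (simp add: U_def)
  finally show ?thesis .
qed

text \<open>The walk drifts by \<open>1 - 2 * p\<close> per query, down on zero bits and up on one
  bits, so a distance to the expected exit divided by this drift pays for the queries.\<close>

lemma expected_queries_or_test_le: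
  assumes n: "0 < n"
  shows "expected_queries p (or_test n a b) x \<le>
    ennreal ((real n * real a + real b / (1 - r)) / (1 - 2 * p))"
proof -
  \<comment> \<open>\<open>K\<close> bounds the cost of testing one bits only, until the first of them is recognised.\<close>
  define K where "K = real b / (1 - r)"
  \<comment> \<open>A zero bit reserves its height \<open>u\<close>, a one bit its distance to the
    top, and every later bit \<open>a\<close>. The reserve \<open>K\<close> is kept in full on a
    zero bit; on a one bit it is needed again only after a rejection, whence the weight
    \<open>r ^ u\<close>.\<close>
  define U where "U i u = (if i < n then
      ((if x ! i then real (a + b - u) + r ^ u * K else real u + K) + real (n - Suc i) * real a)
        / (1 - 2 * p) else 0)" for i u :: nat
  have pos: "0 < 1 - 2 * p"
    using p by simp
  have cancel: "(1 - 2 * p) * (y / (1 - 2 * p)) = y" for y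
    using pos by simp
  have K: "0 \<le> K" "real b + r * K = K"
    using ratio_bounds by (auto simp: K_def field_simps)
  \<comment> \<open>\<open>K\<close> solves \<open>b + r * K = K\<close>, and
    \<open>r ^ a \<le> r\<close> because \<open>a\<close> is at least 1: entering a one bit is
    covered by \<open>K\<close>.\<close>
  have Kr: "real b + r ^ a * K \<le> K"
  proof -
    have "r ^ a * K \<le> r * K"
      using power_decreasing[of 1 a r] a ratio_bounds K(1) by (intro mult_right_mono) auto
    with K(2) show ?thesis
      by simp
  qed
  have U_nonneg: "0 \<le> case_prod U s" for s
    using ratio_bounds K(1) pos by (auto simp: U_def split: prod.split)
  have start: "(1 - 2 * p) * U i a \<le> real (n - i) * real a + K" for i
  proof (cases "i < n")
    case True
    then have "real (n - i) = 1 + real (n - Suc i)"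
      by linarith
    then have "real (n - i) * real a = real a + real (n - Suc i) * real a"
      by (simp only: distrib_right mult_1)
    with True Kr pos show ?thesis
      by (simp add: U_def cancel del: of_nat_diff)
  qed (use K(1) in \<open>simp add: U_def\<close>)
  have step: "1 + (if x ! i then 1 - p else p) * U i (Suc u) +
      (if x ! i then p else 1 - p) * (if u = 1 then U (Suc i) a else U i (u - 1)) \<le> U i u"
    if *: "i < n" "0 < u" "u < a + b" for i u
  proof -
    define N where "N = real (n - Suc i) * real a"
    define D where "D = (if u = 1 then U (Suc i) a else U i (u - 1))"
    obtain v where v: "u = Suc v"
      using * gr0_conv_Suc by blast
    have "(1 - 2 * p) * (1 + (if x ! i then 1 - p else p) * U i (Suc u) +
        (if x ! i then p else 1 - p) * D) \<le> (1 - 2 * p) * U i u"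
    proof (cases "x ! i")
      case True
      have m: "real (a + b - Suc u) = real (a + b) - real v - 2"
          "real (a + b - u) = real (a + b) - real v - 1"
        using * v by linarith+
      \<comment> \<open>At \<open>u = 1\<close> the right-hand side is the formula for bit
        \<open>i\<close> continued to height 0, namely \<open>a + b + K + N\<close>, while moving on
        needs at most \<open>K + N\<close>.\<close>
      have "(1 - 2 * p) * D \<le> real (a + b) - real v + r ^ v * K + N"
      proof (cases "u = 1")
        case True
        with start[of "Suc i"] v show ?thesis
          by (simp add: D_def N_def)
      next
        case False
        have "real (a + b - (u - 1)) = real (a + b) - real v"
          using * v by linarith
        with False True v pos * show ?thesis
          by (simp add: D_def N_def U_def cancel)
      qed
      then have D: "p * ((1 - 2 * p) * D) \<le> p * (real (a + b) - real v + r ^ v * K + N)"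
        using p by (intro mult_left_mono) auto
      have U: "(1 - 2 * p) * U i (Suc u) = real (a + b) - real v - 2 + r ^ Suc (Suc v) * K + N"
          "(1 - 2 * p) * U i u = real (a + b) - real v - 1 + r ^ Suc v * K + N"
        using * True pos m v unfolding U_def N_def by (simp_all add: cancel)
      \<comment> \<open>The distance to the top shrinks by \<open>1 - 2 * p\<close> on average,
        which pays for the query, and the term with \<open>K\<close> is harmonic.\<close>
      have "p * (real (a + b) - real v + r ^ v * K + N) + (1 - p) * ((1 - 2 * p) * U i (Suc u)) +
          (1 - 2 * p) = (1 - 2 * p) * U i u"
        unfolding U ratio_harmonic'[of v, symmetric] by (simp add: algebra_simps)
      with D True show ?thesis
        by (simp add: algebra_simps)
    next
      case False
      have "(1 - 2 * p) * D \<le> real v + K + N"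
      proof (cases "u = 1")
        case True
        with start[of "Suc i"] v show ?thesis
          by (simp add: D_def N_def)
      next
        case False
        with \<open>\<not> x ! i\<close> v pos * show ?thesis
          by (simp add: D_def N_def U_def cancel)
      qed
      then have D: "(1 - p) * ((1 - 2 * p) * D) \<le> (1 - p) * (real v + K + N)"
        using p by (intro mult_left_mono) auto
      have U: "(1 - 2 * p) * U i (Suc u) = real v + 2 + K + N"
          "(1 - 2 * p) * U i u = real v + 1 + K + N"
        using * False pos v unfolding U_def N_def by (simp_all add: cancel)
      have "(1 - p) * (real v + K + N) + p * ((1 - 2 * p) * U i (Suc u)) + (1 - 2 * p) =
          (1 - 2 * p) * U i u"
        unfolding U by (simp add: algebra_simps)
      with D False show ?thesis
        by (simp add: algebra_simps)
    qed
    with pos show ?thesis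
      by (simp add: D_def)
  qed
  have "expected_queries p (or_test n a b) x \<le> ennreal (case_prod U (test_state a []))"
  proof (rule expected_queries_le)
    show "1 + p * case_prod U (test_state a (h @ [\<not> x ! i])) +
        (1 - p) * case_prod U (test_state a (h @ [x ! i])) \<le> case_prod U (test_state a h)"
      if "or_test n a b h = Query i" for h i
      using or_test_potential_step[OF a that step] by simp
  qed (use p U_nonneg in auto)
  also have "\<dots> \<le> ennreal ((real n * real a + real b / (1 - r)) / (1 - 2 * p))"
    using start[of 0] pos
    by (intro ennreal_leI) (simp add: K_def[symmetric] pos_le_divide_eq mult.commute)
  finally show ?thesis .
qed

lemma error_prob_or_test_le:
  assumes "0 < n" "length x = n"
  shows "error_prob p (or_test n a b) x \<le> max (r ^ a) (real n * r ^ b)"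
proof -
  have "expected_queries p (or_test n a b) x < \<infinity>"
    using expected_queries_or_test_le[OF assms(1)] by (rule order.strict_trans1) simp
  then have E: "error_prob p (or_test n a b) x =
      measure (noise p) {z \<in> space (noise p). outputs (or_test n a b) x z (\<not> OR x)}"
    by (rule error_prob_eq_prob_wrong_output)
  show ?thesis
  proof (cases "OR x")
    case True
    then obtain k where "k < n" "x ! k"
      using assms by (auto simp: OR_def)
    from prob_false_negative_le[OF this] True E show ?thesis
      by simp
  next
    case False
    then have "\<And>i. i < n \<Longrightarrow> \<not> x ! i"
      using assms by (auto simp: OR_def)
    from prob_false_positive_le[of x, OF assms(1) this] False E show ?thesis
      by simp
  qed
qed

end

section \<open>Choice of the thresholds\<close>

text \<open>The exponent is the logarithm of \<open>1 / y\<close> to base \<open>1 / r\<close>,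
  rounded up; for \<open>y > 1\<close> it is clamped to 0.\<close>

lemma power_nat_ceiling_le:
  fixes r y :: real
  assumes "0 < r" "r < 1" "0 < y"
  shows "r ^ nat \<lceil>ln (1 / y) / ln (1 / r)\<rceil> \<le> y"
proof -
  let ?m = "nat \<lceil>ln (1 / y) / ln (1 / r)\<rceil>"
  have "0 < ln (1 / r)"
    using assms by simp
  moreover have "ln (1 / y) / ln (1 / r) \<le> real ?m"
    by linarith
  ultimately have "ln (1 / y) \<le> real ?m * ln (1 / r)"
    by (simp add: pos_divide_le_eq)
  then have "ln (r ^ ?m) \<le> ln y"
    using assms by (simp add: ln_realpow ln_div)
  with assms show ?thesis
    by simp
qed

theorem theorem2:
  fixes p :: real and \<delta> :: "nat \<Rightarrow> real"
  assumes "0 < p" and "p < 1 / 2"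
    and "\<And>n. n \<ge> 1 \<Longrightarrow> 0 < \<delta> n"
    and "\<delta> \<longlonglongrightarrow> 0"
  shows "\<exists>(A :: nat \<Rightarrow> algorithm) (\<epsilon> :: nat \<Rightarrow> real).
           \<epsilon> \<longlonglongrightarrow> 0 \<and>
           (\<forall>n\<ge>1. algorithm_on n (A n) \<and>
              (\<forall>x :: bool list. length x = n \<longrightarrow>
                 error_prob p (A n) x \<le> \<delta> n \<and>
                 expected_queries p (A n) x
                   \<le> ennreal ((1 + \<epsilon> n) * (real n * ln (1 / \<delta> n) / KL_bernoulli p (1 - p)))))"
proof -
  define r where "r = p / (1 - p)"
  define l where "l = ln (1 / r)"
  define L where "L n = ln (1 / \<delta> n)" for n
  define a where "a n = nat \<lceil>L n / l\<rceil>" for n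
  define b where "b n = nat \<lceil>ln (1 / (\<delta> n / real n)) / l\<rceil>" for n
  \<comment> \<open>If \<open>\<delta> n \<ge> 1\<close>, any answer meets the error bound, so none
    of the bits is queried.\<close>
  define A where "A n = (if \<delta> n < 1 then or_test n (a n) (b n) else (\<lambda>h. Output False))" for n
  \<comment> \<open>The relative excess left by rounding \<open>a n\<close> up and by the one-bit
    reserve, after division by \<open>n * L n\<close>. The logarithm of \<open>n\<close> enters only
    through \<open>b n\<close>, hence divided by \<open>n\<close>.\<close>
  define e where "e n = l * inverse (L n) +
    (ln (real n) / real n * inverse (L n) + inverse (real n) +
      l * (inverse (real n) * inverse (L n))) / (1 - r)" for n
  \<comment> \<open>For \<open>\<delta> n > 1\<close> the logarithm is negative; \<open>\<epsilon> n = -1\<close> makes the bound \<open>0\<close>.\<close>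
  define \<epsilon> where "\<epsilon> n = (if \<delta> n < 1 then e n else - 1)" for n
  have r: "0 < r" "r < 1"
    using assms(1,2) by (auto simp: r_def field_simps)
  then have l: "0 < l"
    by (simp add: l_def)
  have D: "KL_bernoulli p (1 - p) = (1 - 2 * p) * l"
    using assms(1,2) by (simp add: KL_bernoulli_compl l_def r_def)
  have "\<forall>\<^sub>F n in sequentially. \<delta> n \<in> {0<..} \<and> \<delta> n \<noteq> 0"
    using eventually_ge_at_top[of 1] by eventually_elim (use assms(3) in force)
  then have "filterlim \<delta> (at_right 0) sequentially"
    using assms(4) by (simp add: filterlim_at)
  then have "filterlim L at_top sequentially"
    unfolding L_def by (rule filterlim_compose[rotated]) real_asymp
  then have invL: "(\<lambda>n. inverse (L n)) \<longlonglongrightarrow> 0"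
    by (rule filterlim_compose[OF tendsto_inverse_0_at_top[OF filterlim_ident]])
  have "e \<longlonglongrightarrow> l * 0 + (0 * 0 + 0 + l * (0 * 0)) / (1 - r)"
    unfolding e_def using r invL
    by (intro tendsto_intros) (auto simp: lim_inverse_n)
  \<comment> \<open>Eventually \<open>\<delta> n < 1\<close>, so the exceptional case does not
    affect the limit.\<close>
  moreover have "\<forall>\<^sub>F n in sequentially. e n = \<epsilon> n"
    using order_tendstoD(2)[OF assms(4), of 1] by (auto simp: \<epsilon>_def elim: eventually_mono)
  ultimately have "\<epsilon> \<longlonglongrightarrow> 0"
    by (simp add: tendsto_cong)
  moreover have "algorithm_on n (A n)" for n
    using algorithm_on_or_test by (simp add: A_def algorithm_on_def)
  moreover have "error_prob p (A n) x \<le> \<delta> n \<and>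
      expected_queries p (A n) x
        \<le> ennreal ((1 + \<epsilon> n) * (real n * L n / KL_bernoulli p (1 - p)))"
    if n: "n \<ge> 1" and x: "length x = n" for n x
  proof (cases "\<delta> n < 1")
    case True
    have \<delta>: "0 < \<delta> n"
      using n by (rule assms(3))
    have L: "0 < L n"
      using True \<delta> by (simp add: L_def)
    then have a_pos: "0 < a n"
      using l by (simp add: a_def)
    have ra: "r ^ a n \<le> \<delta> n"
      using power_nat_ceiling_le[OF r \<delta>] by (simp add: a_def L_def l_def)
    have rb: "real n * r ^ b n \<le> \<delta> n"
      using power_nat_ceiling_le[OF r, of "\<delta> n / real n"] n \<delta>
      by (simp add: b_def l_def field_simps)
    have "real (a n) \<le> L n / l + 1"
      using L l unfolding a_def by (smt (verit) divide_pos_pos of_nat_nat ceiling_correct zero_le_ceiling)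
    then have al: "real (a n) * l \<le> L n + l"
      using l by (simp add: field_simps)
    have lnn: "ln (1 / (\<delta> n / real n)) = ln (real n) + L n" "0 \<le> ln (real n)"
      using n \<delta> by (simp_all add: L_def ln_div)
    have "0 < (ln (real n) + L n) / l"
      using lnn(2) L l by simp
    then have "real (b n) \<le> (ln (real n) + L n) / l + 1"
      unfolding b_def lnn(1) by linarith
    then have bl: "real (b n) * l \<le> ln (real n) + L n + l"
      using l by (simp add: field_simps)
    \<comment> \<open>Multiplying the cost by \<open>l\<close> turns the thresholds into logarithms;
      dividing by \<open>(1 - 2 * p) * l\<close> afterwards produces the divergence.\<close>
    have "(real n * real (a n) + real (b n) / (1 - r)) * l =
        real n * (real (a n) * l) + real (b n) * l / (1 - r)"
      by (simp add: algebra_simps)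
    also have "\<dots> \<le> real n * (L n + l) + (ln (real n) + L n + l) / (1 - r)"
      using al bl r by (intro add_mono mult_left_mono divide_right_mono) auto
    also have "\<dots> = (1 + e n) * (real n * L n)"
      using n L r unfolding e_def by (simp add: divide_simps) (simp add: algebra_simps)
    finally have "(real n * real (a n) + real (b n) / (1 - r)) * l \<le> (1 + e n) * (real n * L n)" .
    then have "(real n * real (a n) + real (b n) / (1 - r)) / (1 - 2 * p) \<le>
        (1 + e n) * (real n * L n / KL_bernoulli p (1 - p))"
      using l assms(2) unfolding D by (simp add: divide_simps mult.commute)
    then have "expected_queries p (or_test n (a n) (b n)) x \<le>
        ennreal ((1 + e n) * (real n * L n / KL_bernoulli p (1 - p)))"
      using expected_queries_or_test_le[OF assms(1,2) r_def a_pos, of n "b n" x] n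
      by (meson ennreal_leI order_trans less_le_trans zero_less_one)
    moreover have "error_prob p (or_test n (a n) (b n)) x \<le> \<delta> n"
      using error_prob_or_test_le[OF assms(1,2) r_def a_pos, of n x "b n"] n x ra rb by simp
    ultimately show ?thesis
      using True by (simp add: A_def \<epsilon>_def)
  next
    case False
    have "history (A n) x z t = []" for z t
      using False by (induction t) (auto simp: A_def)
    then have "num_queries (A n) x z = 0" for z
      by (simp add: num_queries_eq_SUP_length zero_enat_def)
    moreover have "error_prob p (A n) x \<le> 1"
      unfolding error_prob_def by (rule prob_space.prob_le_1[OF prob_space_noise])
    ultimately show ?thesis
      using False by (simp add: \<epsilon>_def expected_queries_def)
  qed
  ultimately show ?thesis
    unfolding L_def by (intro exI[of _ A] exI[of _ \<epsilon>]) simp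
qed

end
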